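(* Let $n\ge 1$ be an integer and let $f_1,\dots,f_n$ be $n$ continuous and strictly increasing real-valued functions defined on $\mathbb{R}_{\ge 0}$ such that $0<f_1'\le f_2'\le\cdots\le f_n'$ almost everywhere and $\lim_{x\to\infty}f_1(x)=\infty$. Then there exists $t>0$ such that $$\min\{\|f_i(t)\|_{\mathbb{R}/\mathbb{Z}} : 1\le i\le n\}\ge 2^{-n}.$$ Moreover, the number $2^{-n}$ is the best possible, i.e. it cannot be replaced by a larger number.
   Context: For $x\in\mathbb{R}$, $\|x\|_{\mathbb{R}/\mathbb{Z}}$ denotes the distance from $x$ to the nearest integer. $f_i'$ denotes the derivative of $f_i$, which exists almost everywhere since $f_i$ is monotone.
   Formalization: The formal version also assumes f_1,…,f_{n-1} absolutely continuous on every [0,r] (nothing extra on f_n). Without this the claim fails for n ≥ 2: two alternating Cantor staircases plus a small common smooth increasing function meet all stated hypotheses. *)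

theory Defs
  imports "HOL-Analysis.Analysis"
begin

definition dist_int :: "real \<Rightarrow> real"  (\<open>\<parallel>_\<parallel>\<^sub>\<int>\<close>)
  where "\<parallel>x\<parallel>\<^sub>\<int> = infdist x \<int>"

(* The usual epsilon-delta definition.  The set D runs over the finite families of
   non-overlapping compact intervals K = [Inf K, Sup K] contained in S. *)
definition abs_continuous_on :: "real set \<Rightarrow> (real \<Rightarrow> real) \<Rightarrow> bool"
  where "abs_continuous_on S f \<longleftrightarrow>
    (\<forall>\<epsilon>>0. \<exists>\<delta>>0. \<forall>D. D division_of \<Union>D \<and> \<Union>D \<subseteq> S \<and> (\<Sum>K\<in>D. Sup K - Inf K) < \<delta> \<longrightarrow>
      (\<Sum>K\<in>D. \<bar>f (Sup K) - f (Inf K)\<bar>) < \<epsilon>)"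

(* The functions are f 1, ..., f n, and only their values on [0, \<infinity>) matter.

   An inequality between derivatives that holds almost everywhere includes the existence of
   these derivatives almost everywhere; for monotone functions this is automatic (Lebesgue),
   and it is written out because deriv has an unspecified value at other points.

   Local absolute continuity is what allows the almost-everywhere inequality
   f i' \<le> f (i + 1)' to be integrated to f i y - f i x \<le> f (i + 1) y - f (i + 1) x.  It is
   needed only for the smaller function of each pair, so nothing is required of f n, and
   nothing at all if n = 1.  For n \<ge> 2 it cannot be omitted: put e x = x / (100 * (1 + x)), let
   a be the continuous staircase that climbs from k to k + 1 on [k, k + 1/2] along a copy of
   the Cantor function and is constant on [k + 1/2, k + 1], for every natural number k, and
   let b be the same with the two halves of [k, k + 1] exchanged.  Then f 1 = a + e and
   f 2 = ... = f n = b + e are continuous, strictly increasing and unbounded, and all their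
   derivatives equal e' > 0 almost everywhere; but at every point a or b is an integer, so
   one of the distances to the nearest integer is always below 1/100.  With any e0 > 0 in
   place of 1/100 the same holds, so no positive bound would be true. *)
definition ordered_slopes :: "nat \<Rightarrow> (nat \<Rightarrow> real \<Rightarrow> real) \<Rightarrow> bool"
  where "ordered_slopes n f \<longleftrightarrow>
    (\<forall>i\<in>{1..n}. continuous_on {0..} (f i) \<and> strict_mono_on {0..} (f i)) \<and>
    (\<forall>i\<in>{1..<n}. \<forall>r\<ge>0. abs_continuous_on {0..r} (f i)) \<and>
    (AE x in lebesgue. 0 < x \<longrightarrow>
      (\<forall>i\<in>{1..n}. f i differentiable (at x)) \<and>
      0 < deriv (f 1) x \<and>
      (\<forall>i\<in>{1..<n}. deriv (f i) x \<le> deriv (f (i + 1)) x)) \<and>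
    filterlim (f 1) at_top at_top"

end

theory Submission
  imports Defs
begin

text \<open>
  For the existence of \<open>t\<close>, the functions are treated in the order of their slopes, slowest first.
  Let \<open>\<delta> = 1 / 2 ^ n\<close>, call a value good if its distance to the integers is at least \<open>\<delta>\<close>, and
  suppose that on an interval of times the next function increases by at least \<open>l - 2 * \<delta>\<close>, where
  \<open>4 * \<delta> \<le> l \<le> 2\<close>.  The unit interval between consecutive integers that contains the middle of the range
  has a good part that meets the range in a segment of length at least \<open>l / 2 - 2 * \<delta>\<close>
  (\<open>subinterval_far_from_int\<close>), and one can restrict to the times at which the value lies in this
  segment.  The following function is at least as fast, so it increases on the smaller interval by
  at least as much, and the step can be repeated with \<open>l / 2\<close>.  As \<open>f 1\<close> is unbounded, one can
  start with \<open>l = 2\<close>; then the last step, for \<open>f n\<close>, has \<open>l = 4 * \<delta>\<close>, and it leaves at least one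
  point (\<open>nested_intervals_far_from_int\<close>).

  That a larger derivative almost everywhere gives larger increments is proved from Cousin's lemma:
  in a sufficiently fine tagged division, the cells whose tags are ordinary points are controlled
  by the derivatives there, and the cells tagged in the exceptional null set have small total
  length, so that the absolutely continuous smaller function hardly changes on them, while the
  larger function at least does not decrease (\<open>increment_le_if_deriv_le\<close>).

  For the sharpness, piecewise linear functions are constructed such that at each time some function
  is within \<open>1 / 2 ^ n\<close> of an integer.  The time axis is cut into unit cells, and a cell
  \<open>[m, m + 1]\<close> is assigned to a function by the power of 2 in \<open>m\<close>: to \<open>f (n - v)\<close> if
  \<open>v < n - 1\<close> is the exponent of 2 in \<open>m\<close>, and to \<open>f 1\<close> if \<open>2 ^ (n - 1)\<close> divides \<open>m\<close>.  On its own
  cells a function moves from \<open>k - 1 / 2 ^ n\<close> to \<open>k + 1 / 2 ^ n\<close> for an integer \<open>k\<close>.  For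
  \<open>i \<ge> 2\<close>, the cells of \<open>f i\<close> form an arithmetic progression; between two consecutive ones there is exactly
  one cell assigned to functions of smaller index, and on it \<open>f i\<close> makes up what is missing from an
  increase by 1.  Elsewhere all functions have the common slope \<open>2 / 2 ^ n\<close>.  The cells on
  which \<open>f i\<close> is fast are among those on which \<open>f (i + 1)\<close> is fast, which is why the slopes are ordered.
\<close>

section \<open>Increments and derivatives almost everywhere\<close>

lemma null_set_in_small_open:
  fixes N :: "real set"
  assumes "N \<in> null_sets lebesgue" "0 < d"
  obtains U where "open U" "N \<subseteq> U" "U \<in> lmeasurable" "measure lebesgue U < d"
proof -
  obtain U where U: "open U" "N \<subseteq> U" "U - N \<in> lmeasurable" "emeasure lebesgue (U - N) < ennreal d"
    using sets_lebesgue_outer_open[of N d] assms by (auto simp: null_sets_def)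
  have Ulm: "U \<in> sets lebesgue" using U(1) by auto
  have eq: "emeasure lebesgue (U - N) = emeasure lebesgue U"
    using assms(1) Ulm by (rule emeasure_Diff_null_set)
  have lm: "U \<in> lmeasurable"
    using U(4) Ulm unfolding eq by (intro fmeasurableI) (auto simp: less_top[symmetric] intro: less_trans)
  have "measure lebesgue U < d"
    using U(4) assms(2) emeasure_eq_measure2[OF lm] unfolding eq by (simp add: ennreal_less_iff)
  with U lm show ?thesis using that by blast
qed

lemma division_length_le_measure:
  fixes U :: "real set"
  assumes "D division_of \<Union>D" "\<Union>D \<subseteq> U" "U \<in> lmeasurable"
  shows "(\<Sum>K\<in>D. Sup K - Inf K) \<le> measure lebesgue U"
proof -
  have "(\<Sum>K\<in>D. Sup K - Inf K) = (\<Sum>K\<in>D. measure lebesgue K)"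
  proof (rule sum.cong[OF refl])
    fix K assume "K \<in> D"
    then obtain u v where "K = {u..v}" "u \<le> v"
      using division_ofD(3,4)[OF assms(1)] by (metis atLeastatMost_empty_iff2 box_real(2))
    then show "Sup K - Inf K = measure lebesgue K" by simp
  qed
  also have "\<dots> = measure lebesgue (\<Union>D)"
    using assms(1) by (rule content_division)
  also have "\<dots> \<le> measure lebesgue U"
    using assms by (intro measure_mono_fmeasurable) (auto simp: lmeasurable_division fmeasurableD)
  finally show ?thesis .
qed

text \<open>The straddle form of differentiability: the two ends of an interval around \<open>x\<close> move
  independently, since the error terms at \<open>u\<close> and \<open>v\<close> are bounded by the distances to \<open>x\<close>, and these
  add up to \<open>v - u\<close>.\<close>

lemma nonneg_deriv_straddle:
  fixes h :: "real \<Rightarrow> real"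
  assumes "(h has_real_derivative D) (at x)" "0 \<le> D" "0 < e"
  obtains d where "0 < d"
    "\<And>u v. x - d < u \<Longrightarrow> u \<le> x \<Longrightarrow> x \<le> v \<Longrightarrow> v < x + d \<Longrightarrow> - e * (v - u) \<le> h v - h u"
proof -
  obtain d where d: "0 < d" and *: "\<And>y. norm (y - x) < d \<Longrightarrow> norm (h y - h x - D * (y - x)) \<le> e * norm (y - x)"
    using assms(1,3) unfolding has_field_derivative_def has_derivative_at_alt by blast
  show ?thesis
  proof (rule that[OF d])
    fix u v assume "x - d < u" "u \<le> x" "x \<le> v" "v < x + d"
    then have 1: "\<bar>h u - h x - D * (u - x)\<bar> \<le> e * (x - u)"
      "\<bar>h v - h x - D * (v - x)\<bar> \<le> e * (v - x)" using *[of u] *[of v] by simp_all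
    have "0 \<le> D * (v - x)" "0 \<le> D * (x - u)" using assms(2) \<open>u \<le> x\<close> \<open>x \<le> v\<close> by simp_all
    with 1 show "- e * (v - u) \<le> h v - h u"
      by (simp add: abs_le_iff algebra_simps)
  qed
qed

text \<open>On a cell tagged at an ordinary point, \<open>g - f\<close> drops by at most \<open>e\<close> times the length of the cell.
  The cells tagged in \<open>N\<close> lie in an open set of measure less than \<open>\<delta>\<close>, so \<open>f\<close> gains less than \<open>e\<close>
  on them in total, whereas \<open>g\<close> does not decrease.  Absolute continuity thus excludes the one way in which
  \<open>g - f\<close> could fall behind: a rise of \<open>f\<close> concentrated on a null set.\<close>

lemma increment_le_if_deriv_le:
  fixes f g :: "real \<Rightarrow> real"
  assumes "a \<le> b" and ac: "abs_continuous_on {a..b} f" and mono: "mono_on {a..b} g"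
    and null: "N \<in> null_sets lebesgue"
    and deriv: "\<And>x. x \<in> {a..b} - N \<Longrightarrow>
      f differentiable (at x) \<and> g differentiable (at x) \<and> deriv f x \<le> deriv g x"
  shows "f b - f a \<le> g b - g a"
proof (rule field_le_epsilon)
  fix \<eta> :: real assume "\<eta> > 0"
  \<comment> \<open>The ordinary cells cost at most \<open>e * (b - a)\<close> and the exceptional ones at most \<open>e\<close>.\<close>
  define e where "e = \<eta> / (b - a + 1)"
  have e: "0 < e" "e * (b - a + 1) = \<eta>"
    using \<open>\<eta> > 0\<close> \<open>a \<le> b\<close> by (simp_all add: e_def)
  define h where "h = (\<lambda>x. g x - f x)"
  obtain \<delta> where \<delta>: "\<delta> > 0" and small: "\<And>D. D division_of \<Union>D \<Longrightarrow> \<Union>D \<subseteq> {a..b} \<Longrightarrow>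
      (\<Sum>K\<in>D. Sup K - Inf K) < \<delta> \<Longrightarrow> (\<Sum>K\<in>D. \<bar>f (Sup K) - f (Inf K)\<bar>) < e"
    using ac[unfolded abs_continuous_on_def, rule_format, OF e(1)] by blast
  obtain U where U: "open U" "N \<subseteq> U" "U \<in> lmeasurable" "measure lebesgue U < \<delta>"
    using null_set_in_small_open[OF null \<delta>] .
  have "\<exists>d>0. (x \<in> N \<longrightarrow> ball x d \<subseteq> U) \<and> (x \<in> {a..b} - N \<longrightarrow>
      (\<forall>u v. x - d < u \<and> u \<le> x \<and> x \<le> v \<and> v < x + d \<longrightarrow> - e * (v - u) \<le> h v - h u))" for x
  proof (cases "x \<in> N")
    case True
    then show ?thesis using U(1,2) by (meson DiffD2 open_contains_ball subsetD)
  next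
    case False
    show ?thesis
    proof (cases "x \<in> {a..b}")
      case True
      with False have x: "f differentiable (at x)" "g differentiable (at x)" "deriv f x \<le> deriv g x"
        using deriv by auto
      have "(h has_real_derivative (deriv g x - deriv f x)) (at x)"
        unfolding h_def using x(1,2)
        by (intro derivative_intros) (auto simp: DERIV_deriv_iff_real_differentiable)
      from nonneg_deriv_straddle[OF this _ e(1)] x(3) False show ?thesis by (smt (verit) DiffD2)
    qed (use False in \<open>auto intro: exI[of _ 1]\<close>)
  qed
  then obtain r where r: "\<And>x. r x > 0" "\<And>x. x \<in> N \<Longrightarrow> ball x (r x) \<subseteq> U"
    "\<And>x u v. x \<in> {a..b} - N \<Longrightarrow> x - r x < u \<Longrightarrow> u \<le> x \<Longrightarrow> x \<le> v \<Longrightarrow> v < x + r x \<Longrightarrow>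
        - e * (v - u) \<le> h v - h u"
    by metis
  have "gauge (\<lambda>x. ball x (r x))" using r(1) by (simp add: gauge_def)
  then obtain p where p: "p tagged_division_of {a..b}" "(\<lambda>x. ball x (r x)) fine p"
    using fine_division_exists_real by blast
  have interval: "\<exists>u v. K = {u..v} \<and> u \<le> x \<and> x \<le> v \<and> a \<le> u \<and> v \<le> b \<and> K \<subseteq> ball x (r x)"
    if "(x, K) \<in> p" for x K
    using tagged_division_ofD(2-4)[OF p(1) that] fineD[OF p(2) that]
    by (metis atLeastAtMost_iff atLeastatMost_subset_iff box_real(2) order_trans)
  define q where "q = {z \<in> p. fst z \<in> N}"
  have qp: "q \<subseteq> p" and fin: "finite p" using p(1) by (auto simp: q_def)
  define D where "D = snd ` q"
  have part: "q tagged_partial_division_of {a..b}"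
    using p(1) qp tagged_partial_division_subset unfolding tagged_division_of_def by blast
  have D: "D division_of \<Union>D" unfolding D_def using part by (rule partial_division_of_tagged_division)
  have DU: "\<Union>D \<subseteq> U" "\<Union>D \<subseteq> {a..b}"
    using interval r(2) by (fastforce simp: D_def q_def)+
  have "(\<Sum>K\<in>D. \<bar>f (Sup K) - f (Inf K)\<bar>) = (\<Sum>z\<in>q. \<bar>f (Sup (snd z)) - f (Inf (snd z))\<bar>)"
    unfolding D_def
  proof (subst sum.reindex_nontrivial)
    show "finite q" using fin qp by (rule rev_finite_subset)
    \<comment> \<open>A cell that occurs with two different tags has empty interior, so it is a single point.\<close>
    fix y z assume yz: "y \<in> q" "z \<in> q" "y \<noteq> z" "snd y = snd z"
    obtain u v where uv: "snd y = {u..v}" "u \<le> v"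
      using interval[of "fst y" "snd y"] yz(1) qp by (metis order_trans prod.collapse subsetD)
    have "interior (snd y) \<inter> interior (snd z) = {}"
      using tagged_partial_division_ofD(5)[OF part, of "fst y" "snd y" "fst z" "snd z"] yz
      by (metis prod.collapse)
    then have "u = v" using uv yz(4) by auto
    then show "\<bar>f (Sup (snd y)) - f (Inf (snd y))\<bar> = 0" using uv by simp
  qed simp
  then have "(\<Sum>(x,K)\<in>q. \<bar>f (Sup K) - f (Inf K)\<bar>) = (\<Sum>K\<in>D. \<bar>f (Sup K) - f (Inf K)\<bar>)"
    by (simp add: split_def)
  also have "\<dots> < e"
    using division_length_le_measure[OF D DU(1) U(3)] U(4) by (intro small D DU(2)) simp
  finally have q_small: "(\<Sum>(x,K)\<in>q. \<bar>f (Sup K) - f (Inf K)\<bar>) < e" .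
  have "(\<Sum>(x,K)\<in>p. - e * (Sup K - Inf K)) - (\<Sum>(x,K)\<in>q. \<bar>f (Sup K) - f (Inf K)\<bar>)
      = (\<Sum>(x,K)\<in>p. - e * (Sup K - Inf K) - (if x \<in> N then \<bar>f (Sup K) - f (Inf K)\<bar> else 0))"
    using fin by (simp add: q_def sum_subtractf sum.inter_filter split_def)
  also have "\<dots> \<le> (\<Sum>(x,K)\<in>p. h (Sup K) - h (Inf K))"
  proof (rule sum_mono, clarify)
    fix x K assume xK: "(x, K) \<in> p"
    then obtain u v where uv: "K = {u..v}" "u \<le> x" "x \<le> v" "a \<le> u" "v \<le> b" "K \<subseteq> ball x (r x)"
      using interval by blast
    have *: "Sup K = v" "Inf K = u" using uv by auto
    show "- e * (Sup K - Inf K) - (if x \<in> N then \<bar>f (Sup K) - f (Inf K)\<bar> else 0)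
        \<le> h (Sup K) - h (Inf K)"
    proof (cases "x \<in> N")
      case True
      have "g u \<le> g v" using mono uv by (auto simp: mono_on_def)
      moreover have "0 \<le> e * (v - u)" using e(1) uv by simp
      ultimately show ?thesis using True unfolding * h_def by simp
    next
      case False
      have "u \<in> ball x (r x)" "v \<in> ball x (r x)"
        using uv(1-3) uv(6) by (auto simp del: mem_ball)
      then have "- e * (v - u) \<le> h v - h u"
        using False uv by (intro r(3)[of x]) (auto simp: dist_real_def)
      then show ?thesis using False unfolding * by simp
    qed
  qed
  also have "\<dots> = h b - h a" using additive_tagged_division_1[OF \<open>a \<le> b\<close> p(1)] .
  finally have "(\<Sum>(x,K)\<in>p. - e * (Sup K - Inf K)) - e \<le> h b - h a" using q_small by simp
  moreover have "(\<Sum>(x,K)\<in>p. - e * (Sup K - Inf K)) = - e * (b - a)"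
    using additive_tagged_division_1[OF \<open>a \<le> b\<close> p(1), of "\<lambda>x. - e * x"]
    by (simp add: algebra_simps)
  ultimately show "f b - f a \<le> g b - g a + \<eta>" using e(2) by (simp add: h_def algebra_simps)
qed

section \<open>Values far from the integers\<close>

lemma dist_int_ge:
  assumes "of_int k + \<delta> \<le> x" "x \<le> of_int k + 1 - \<delta>"
  shows "\<delta> \<le> \<parallel>x\<parallel>\<^sub>\<int>"
proof -
  have "\<delta> \<le> dist x j" if "j \<in> \<int>" for j
  proof -
    from that obtain m where m: "j = of_int m" by (rule Ints_cases)
    have "m \<le> k \<or> k + 1 \<le> m" by linarith
    then have "real_of_int m \<le> k \<or> real_of_int k + 1 \<le> m" by (metis of_int_1 of_int_add of_int_le_iff)
    with assms show ?thesis by (auto simp: dist_real_def m)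
  qed
  then show ?thesis unfolding dist_int_def infdist_def
    by (auto intro!: cINF_greatest)
qed

text \<open>The segment is the intersection of \<open>[p, q]\<close> with \<open>[k + \<delta>, k + 1 - \<delta>]\<close>, where \<open>[k, k + 1]\<close>
  contains the midpoint of \<open>[p, q]\<close>.  In the extreme case the midpoint is an integer, and the
  interval of bad points around it splits \<open>[p, q]\<close> into two halves of length \<open>l / 2 - 2 * \<delta>\<close>.\<close>

lemma subinterval_far_from_int:
  fixes p q :: real
  assumes "\<delta> \<ge> 0" "4 * \<delta> \<le> l" "l \<le> 2" "l - 2 * \<delta> \<le> q - p"
  obtains p' q' where "p \<le> p'" "p' \<le> q'" "q' \<le> q" "l / 2 - 2 * \<delta> \<le> q' - p'"
    "\<And>y. p' \<le> y \<Longrightarrow> y \<le> q' \<Longrightarrow> \<delta> \<le> \<parallel>y\<parallel>\<^sub>\<int>"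
proof -
  define c where "c = (p + q) / 2"
  define k where "k = \<lfloor>c\<rfloor>"
  have k: "of_int k \<le> c" "c < of_int k + 1" by (auto simp: k_def)
  have c2: "2 * c = p + q" by (simp add: c_def)
  show ?thesis
  proof (rule that)
    show "p \<le> max p (of_int k + \<delta>)" "min q (of_int k + 1 - \<delta>) \<le> q" by auto
    show "l / 2 - 2 * \<delta> \<le> min q (of_int k + 1 - \<delta>) - max p (of_int k + \<delta>)"
      using assms k c2 by (auto simp: min_def max_def)
    with assms show "max p (of_int k + \<delta>) \<le> min q (of_int k + 1 - \<delta>)" by linarith
    show "\<delta> \<le> \<parallel>y\<parallel>\<^sub>\<int>" if "max p (of_int k + \<delta>) \<le> y" "y \<le> min q (of_int k + 1 - \<delta>)" for y
      using that by (intro dist_int_ge[of k]) auto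
  qed
qed

lemma ordered_slopes_increment_le:
  assumes "ordered_slopes n f" "i \<in> {1..<n}" "0 < a" "a \<le> b"
  shows "f i b - f i a \<le> f (i + 1) b - f (i + 1) a"
proof -
  note os = assms(1)[unfolded ordered_slopes_def]
  have "AE x in lebesgue. 0 < x \<longrightarrow> (\<forall>i\<in>{1..n}. f i differentiable (at x)) \<and>
      0 < deriv (f 1) x \<and> (\<forall>i\<in>{1..<n}. deriv (f i) x \<le> deriv (f (i + 1)) x)"
    using os by blast
  then obtain N where "\<And>x. x \<in> space lebesgue - N \<Longrightarrow>
      0 < x \<longrightarrow> (\<forall>i\<in>{1..n}. f i differentiable (at x)) \<and>
      0 < deriv (f 1) x \<and> (\<forall>i\<in>{1..<n}. deriv (f i) x \<le> deriv (f (i + 1)) x)"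
    and N: "N \<in> null_sets lebesgue"
    by (rule AE_E3) blast
  then have deriv: "(\<forall>i\<in>{1..n}. f i differentiable (at x)) \<and>
      (\<forall>i\<in>{1..<n}. deriv (f i) x \<le> deriv (f (i + 1)) x)" if "x \<notin> N" "0 < x" for x
    using that by auto
  show ?thesis
  proof (rule increment_le_if_deriv_le[OF \<open>a \<le> b\<close> _ _ N])
    have "abs_continuous_on {0..b} (f i)" using os assms(2-4) by auto
    moreover have "{a..b} \<subseteq> {0..b}" using \<open>0 < a\<close> by auto
    ultimately show "abs_continuous_on {a..b} (f i)"
      unfolding abs_continuous_on_def by (meson order_trans)
    have "strict_mono_on {0..} (f (i + 1))" using os assms(2) by auto
    then show "mono_on {a..b} (f (i + 1))"
      using \<open>0 < a\<close> by (intro mono_onI) (auto intro: strict_mono_on_leD)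
    show "f i differentiable at x \<and> f (i + 1) differentiable at x \<and> deriv (f i) x \<le> deriv (f (i + 1)) x"
      if "x \<in> {a..b} - N" for x
      using that deriv[of x] assms(2,3) by auto
  qed
qed

text \<open>The induction carries along the gain of the first function not treated yet.  It halves up to the
  correction \<open>2 / 2 ^ n\<close>: the segment of values chosen for \<open>f (k + 1)\<close> is a gain of \<open>f (k + 1)\<close>, and
  \<open>f (k + 2)\<close> gains at least as much on the same times.\<close>

lemma nested_intervals_far_from_int:
  assumes os: "ordered_slopes n f" and "n \<ge> 1" and "k \<le> n"
  shows "\<exists>a b. 0 < a \<and> a \<le> b \<and> (\<forall>i\<in>{1..k}. \<forall>t\<in>{a..b}. 1 / 2 ^ n \<le> \<parallel>f i t\<parallel>\<^sub>\<int>) \<and>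
    (k < n \<longrightarrow> 2 / 2 ^ k - 2 / 2 ^ n \<le> f (k + 1) b - f (k + 1) a)"
  using \<open>k \<le> n\<close>
proof (induction k)
  case 0
  have "filterlim (f 1) at_top at_top" using os by (simp add: ordered_slopes_def)
  then have "\<forall>\<^sub>F b in at_top. f 1 1 + 2 \<le> f 1 b" by (simp add: filterlim_at_top)
  then have "\<forall>\<^sub>F b in at_top. f 1 1 + 2 \<le> f 1 b \<and> 1 \<le> b"
    using eventually_ge_at_top by (rule eventually_conj)
  then obtain b where "f 1 1 + 2 \<le> f 1 b" "1 \<le> b"
    by (auto dest: eventually_happens)
  moreover have "(0::real) \<le> 2 / 2 ^ n" by simp
  ultimately have "2 - 2 / 2 ^ n \<le> f 1 b - f 1 1" by linarith
  with \<open>1 \<le> b\<close> show ?case by (intro exI[of _ 1] exI[of _ b]) auto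
next
  case (Suc k)
  let ?g = "f (Suc k)"
  obtain a b where ab: "0 < a" "a \<le> b"
    and far: "\<And>i t. i \<in> {1..k} \<Longrightarrow> t \<in> {a..b} \<Longrightarrow> 1 / 2 ^ n \<le> \<parallel>f i t\<parallel>\<^sub>\<int>"
    and gain: "2 / 2 ^ k - 2 / 2 ^ n \<le> ?g b - ?g a"
    using Suc by auto
  have "continuous_on {0..} ?g" and mono: "strict_mono_on {0..} ?g"
    using os Suc.prems by (auto simp: ordered_slopes_def)
  then have cont: "continuous_on {s..t} ?g" if "a \<le> s" for s t
    using that ab by (auto intro: continuous_on_subset)
  have le: "?g s \<le> ?g t" if "a \<le> s" "s \<le> t" for s t
    using that ab mono by (auto intro: strict_mono_on_leD)
  have "(2::real) ^ Suc k \<le> 2 ^ n" using Suc.prems by (intro power_increasing) auto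
  then have "4 * (1 / 2 ^ n) \<le> (2 / 2 ^ k :: real)" by (simp add: field_simps)
  moreover have "2 / 2 ^ k \<le> (2::real)" by (simp add: divide_le_eq)
  ultimately obtain p q where pq: "?g a \<le> p" "p \<le> q" "q \<le> ?g b"
      "2 / 2 ^ k / 2 - 2 * (1 / 2 ^ n) \<le> q - p"
    and far': "\<And>y. p \<le> y \<Longrightarrow> y \<le> q \<Longrightarrow> 1 / 2 ^ n \<le> \<parallel>y\<parallel>\<^sub>\<int>"
    using subinterval_far_from_int[of "1 / 2 ^ n" "2 / 2 ^ k" "?g b" "?g a"] gain by auto
  obtain a' where a': "a \<le> a'" "a' \<le> b" "?g a' = p"
    using IVT'[of ?g a p b] pq ab(2) cont[of a b] by auto
  obtain b' where b': "a' \<le> b'" "b' \<le> b" "?g b' = q"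
    using IVT'[of ?g a' q b] pq a' cont[of a' b] by auto
  have "1 / 2 ^ n \<le> \<parallel>f i t\<parallel>\<^sub>\<int>" if "i \<in> {1..Suc k}" "t \<in> {a'..b'}" for i t
  proof (cases "i = Suc k")
    case True
    then show ?thesis using that far'[of "?g t"] le[of a' t] le[of t b'] a' b' by auto
  next
    case False
    then show ?thesis using that far[of i t] a' b' by auto
  qed
  moreover have "2 / 2 ^ Suc k - 2 / 2 ^ n \<le> f (Suc k + 1) b' - f (Suc k + 1) a'" if "Suc k < n"
    using ordered_slopes_increment_le[OF os, of "Suc k" a' b'] that ab a' b' pq(4) by simp
  ultimately show ?case using ab(1) a' b' by (intro exI[of _ a'] exI[of _ b']) auto
qed

section \<open>Piecewise linear functions\<close>

definition interpolate :: "(int \<Rightarrow> real) \<Rightarrow> real \<Rightarrow> real" where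
  "interpolate a x = a \<lfloor>x\<rfloor> + frac x * (a (\<lfloor>x\<rfloor> + 1) - a \<lfloor>x\<rfloor>)"

lemma interpolate_of_int: "interpolate of_int x = x"
  by (simp add: interpolate_def frac_def)

lemma interpolate_diff: "interpolate (\<lambda>m. a m - b m) x = interpolate a x - interpolate b x"
  by (simp add: interpolate_def algebra_simps)

lemma interpolate_mult: "interpolate (\<lambda>m. c * a m) x = c * interpolate a x"
  by (simp add: interpolate_def algebra_simps)

text \<open>Since interpolation is linear in the data, comparing slopes with a constant or with another
  interpolated function always reduces to this lemma.\<close>

lemma interpolate_mono:
  assumes "\<And>m. a m \<le> a (m + 1)" and "x \<le> y"
  shows "interpolate a x \<le> interpolate a y"
proof (cases "\<lfloor>x\<rfloor> = \<lfloor>y\<rfloor>")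
  case True
  then have "frac x \<le> frac y" using \<open>x \<le> y\<close> by (simp add: frac_def)
  then show ?thesis using True assms(1)[of "\<lfloor>y\<rfloor>"] by (simp add: interpolate_def mult_right_mono)
next
  case False
  then have less: "\<lfloor>x\<rfloor> + 1 \<le> \<lfloor>y\<rfloor>" using floor_mono[OF \<open>x \<le> y\<close>] by linarith
  have "frac x * (a (\<lfloor>x\<rfloor> + 1) - a \<lfloor>x\<rfloor>) \<le> 1 * (a (\<lfloor>x\<rfloor> + 1) - a \<lfloor>x\<rfloor>)"
    using assms(1)[of "\<lfloor>x\<rfloor>"] frac_lt_1[of x] by (intro mult_right_mono) auto
  then have "interpolate a x \<le> a (\<lfloor>x\<rfloor> + 1)" by (simp add: interpolate_def)
  also have "\<dots> \<le> a \<lfloor>y\<rfloor>"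
    using less
  proof (induction rule: int_ge_induct)
    case (step i)
    then show ?case using assms(1)[of i] by linarith
  qed simp
  also have "\<dots> \<le> interpolate a y" using assms(1)[of "\<lfloor>y\<rfloor>"] by (simp add: interpolate_def)
  finally show ?thesis .
qed

lemma interpolate_increment_ge:
  assumes "\<And>m. c \<le> a (m + 1) - a m" and "x \<le> y"
  shows "c * (y - x) \<le> interpolate a y - interpolate a x"
  using interpolate_mono[of "\<lambda>m. a m - c * of_int m", OF _ \<open>x \<le> y\<close>] assms(1)
  by (simp add: interpolate_diff interpolate_mult interpolate_of_int algebra_simps)

lemma interpolate_increment_le:
  assumes "\<And>m. a (m + 1) - a m \<le> C" and "x \<le> y"
  shows "interpolate a y - interpolate a x \<le> C * (y - x)"
  using interpolate_mono[of "\<lambda>m. C * of_int m - a m", OF _ \<open>x \<le> y\<close>] assms(1)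
  by (simp add: interpolate_diff interpolate_mult interpolate_of_int algebra_simps)

lemma has_derivative_interpolate:
  assumes "x \<notin> \<int>"
  shows "(interpolate a has_real_derivative (a (\<lfloor>x\<rfloor> + 1) - a \<lfloor>x\<rfloor>)) (at x)"
proof -
  let ?k = "\<lfloor>x\<rfloor>"
  have x: "x \<in> {of_int ?k<..<of_int ?k + 1}"
    using assms floor_less_iff[of x] by (metis Ints_of_int floor_correct greaterThanLessThan_iff of_int_1 of_int_add order_le_less)
  have "((\<lambda>y. a ?k + (y - of_int ?k) * (a (?k + 1) - a ?k)) has_real_derivative (a (?k + 1) - a ?k)) (at x)"
    by (auto intro!: derivative_eq_intros)
  then show ?thesis
  proof (rule has_field_derivative_transform_within_open[OF _ _ x])
    fix y assume "y \<in> {real_of_int ?k<..<real_of_int ?k + 1}"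
    then have "\<lfloor>y\<rfloor> = ?k" by (auto intro!: floor_unique)
    then show "a ?k + (y - of_int ?k) * (a (?k + 1) - a ?k) = interpolate a y"
      by (simp add: interpolate_def frac_def)
  qed simp
qed

lemma abs_continuous_on_lipschitz:
  assumes "\<And>x y. x \<le> y \<Longrightarrow> \<bar>f y - f x\<bar> \<le> C * (y - x)"
  shows "abs_continuous_on S f"
  unfolding abs_continuous_on_def
proof (intro allI impI)
  fix e :: real assume "e > 0"
  define C' where "C' = max C 1"
  have C': "C' > 0" by (simp add: C'_def)
  show "\<exists>d>0. \<forall>D. D division_of \<Union>D \<and> \<Union>D \<subseteq> S \<and> (\<Sum>K\<in>D. Sup K - Inf K) < d \<longrightarrow>
      (\<Sum>K\<in>D. \<bar>f (Sup K) - f (Inf K)\<bar>) < e"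
  proof (intro exI[of _ "e / C'"] conjI allI impI)
    show "0 < e / C'" using \<open>e > 0\<close> C' by simp
    fix D assume D: "D division_of \<Union>D \<and> \<Union>D \<subseteq> S \<and> (\<Sum>K\<in>D. Sup K - Inf K) < e / C'"
    have "(\<Sum>K\<in>D. \<bar>f (Sup K) - f (Inf K)\<bar>) \<le> (\<Sum>K\<in>D. C' * (Sup K - Inf K))"
    proof (rule sum_mono)
      fix K assume "K \<in> D"
      then obtain u v where K: "K = {u..v}" "u \<le> v"
        using D division_ofD(3,4)[of D "\<Union>D"] by (metis atLeastatMost_empty_iff2 box_real(2))
      have "\<bar>f v - f u\<bar> \<le> C * (v - u)" using assms K by blast
      also have "\<dots> \<le> C' * (v - u)" using K(2) by (intro mult_right_mono) (auto simp: C'_def)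
      finally show "\<bar>f (Sup K) - f (Inf K)\<bar> \<le> C' * (Sup K - Inf K)" using K by simp
    qed
    also have "\<dots> = C' * (\<Sum>K\<in>D. Sup K - Inf K)" by (simp add: sum_distrib_left)
    also have "\<dots> < C' * (e / C')" using D C' by (intro mult_strict_left_mono) auto
    finally show "(\<Sum>K\<in>D. \<bar>f (Sup K) - f (Inf K)\<bar>) < e" using C' by simp
  qed
qed

text \<open>All conditions on the functions become conditions on the increments of their values at the
  integers; the integers themselves are a null set, so they can be disregarded for the derivatives.\<close>

lemma ordered_slopes_interpolate:
  assumes "n \<ge> 1" "0 < c"
    and low: "\<And>i m. i \<in> {1..n} \<Longrightarrow> c \<le> a i (m + 1) - a i m"
    and high: "\<And>i m. i \<in> {1..n} \<Longrightarrow> a i (m + 1) - a i m \<le> C"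
    and step: "\<And>i m. i \<in> {1..<n} \<Longrightarrow> a i (m + 1) - a i m \<le> a (i + 1) (m + 1) - a (i + 1) m"
  shows "ordered_slopes n (\<lambda>i. interpolate (a i))"
  unfolding ordered_slopes_def
proof (intro conjI ballI allI impI)
  have ge: "c * (y - x) \<le> interpolate (a i) y - interpolate (a i) x"
    and le: "interpolate (a i) y - interpolate (a i) x \<le> C * (y - x)"
    if "i \<in> {1..n}" "x \<le> y" for i x y
    using that low high by (auto intro!: interpolate_increment_ge interpolate_increment_le)
  have lip: "\<bar>interpolate (a i) y - interpolate (a i) x\<bar> \<le> C * (y - x)"
    if "i \<in> {1..n}" "x \<le> y" for i x y
  proof -
    have "0 \<le> c * (y - x)" using that \<open>0 < c\<close> by simp
    then show ?thesis using ge[OF that] le[OF that] by linarith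
  qed
  have C: "C \<ge> 0" using low[of 1 0] high[of 1 0] assms(1,2) by simp
  fix i
  {
    assume i: "i \<in> {1..n}"
    have "C-lipschitz_on {0..} (interpolate (a i))"
    proof (rule lipschitz_onI[OF _ C])
      fix x y
      show "dist (interpolate (a i) x) (interpolate (a i) y) \<le> C * dist x y"
        using lip[OF i, of x y] lip[OF i, of y x] by (cases "x \<le> y") (auto simp: dist_real_def)
    qed
    then show "continuous_on {0..} (interpolate (a i))" by (rule lipschitz_on_continuous_on)
    show "strict_mono_on {0..} (interpolate (a i))"
    proof (rule strict_mono_onI)
      fix x y :: real assume "x < y"
      then have "0 < c * (y - x)" using \<open>0 < c\<close> by simp
      then show "interpolate (a i) x < interpolate (a i) y" using ge[OF i, of x y] \<open>x < y\<close> by simp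
    qed
  }
  show "abs_continuous_on {0..r} (interpolate (a i))" if "i \<in> {1..<n}" for r
    using that by (intro abs_continuous_on_lipschitz[of _ C] lip) auto
next
  have "AE x in lebesgue. (x::real) \<notin> \<int>"
    by (intro AE_not_in null_sets_completionI countable_imp_null_set_lborel countable_int)
  then show "AE x in lebesgue. 0 < x \<longrightarrow>
      (\<forall>i\<in>{1..n}. interpolate (a i) differentiable at x) \<and>
      0 < deriv (interpolate (a 1)) x \<and>
      (\<forall>i\<in>{1..<n}. deriv (interpolate (a i)) x \<le> deriv (interpolate (a (i + 1))) x)"
  proof eventually_elim
    case (elim x)
    then have "interpolate b differentiable at x"
      "deriv (interpolate b) x = b (\<lfloor>x\<rfloor> + 1) - b \<lfloor>x\<rfloor>" for b
      using has_derivative_interpolate[of x b] by (auto simp: real_differentiable_def intro: DERIV_imp_deriv)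
    then show ?case using low[of 1 "\<lfloor>x\<rfloor>"] assms(1,2) step by auto
  qed
next
  have "filterlim (\<lambda>x. interpolate (a 1) 0 + c * x) at_top at_top"
    by (intro filterlim_tendsto_add_at_top[OF tendsto_const]
        filterlim_tendsto_pos_mult_at_top[OF tendsto_const \<open>0 < c\<close>] filterlim_ident)
  then show "filterlim (interpolate (a 1)) at_top at_top"
  proof (rule filterlim_at_top_mono)
    show "\<forall>\<^sub>F x in at_top. interpolate (a 1) 0 + c * x \<le> interpolate (a 1) x"
      using eventually_ge_at_top[of 0]
    proof eventually_elim
      case (elim x)
      show ?case using interpolate_increment_ge[of c "a 1" 0 x] low[of 1] elim assms(1) by simp
    qed
  qed
qed

section \<open>Functions that are never all far from the integers\<close>

text \<open>The values at the integers of the extremal functions.  For \<open>i \<ge> 2\<close>, the cells assigned to the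
  functions of index smaller than \<open>i\<close> begin at the multiples of \<open>2 ^ (n + 1 - i)\<close>; the quotient counts them, and
  on each of them \<open>f i\<close> gains \<open>1 - 4 / 2 ^ i\<close> in addition to the common slope.  The increase over one
  period \<open>2 ^ (n + 1 - i)\<close> is then \<open>4 / 2 ^ i + (1 - 4 / 2 ^ i) = 1\<close>.  The maximum with 0 matters
  only for \<open>i = 1\<close>, where it makes the function linear.  The constants are chosen such that \<open>f i\<close>
  passes an integer in the middle of its own cells.\<close>

definition covering_values :: "nat \<Rightarrow> nat \<Rightarrow> int \<Rightarrow> real" where
  "covering_values n i m = (2 * of_int m - 1) / 2 ^ n
    + max 0 (1 - 4 / 2 ^ i) * of_int ((m - 1) div 2 ^ (n + 1 - i)) - 2 / 2 ^ i"

lemma div_diff_pred_div: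
  fixes m d :: int
  assumes "0 < d"
  shows "m div d - (m - 1) div d = of_bool (d dvd m)"
proof (cases "d dvd m")
  case True
  then obtain q where "m = d * q" ..
  moreover from this have "(m - 1) div d = q - 1"
    using assms by (intro int_div_pos_eq[where r = "d - 1"]) (auto simp: algebra_simps)
  ultimately show ?thesis using assms by simp
next
  case False
  then have "m mod d \<noteq> 0" by (simp add: dvd_eq_mod_eq_0)
  then have "0 < m mod d" "m mod d < d"
    using pos_mod_sign[OF assms, of m] pos_mod_bound[OF assms, of m] by linarith+
  then have "(m - 1) div d = m div d"
    using div_mult_mod_eq[of m d]
    by (intro int_div_pos_eq[where r = "m mod d - 1"]) (auto simp: algebra_simps)
  then show ?thesis using False by simp
qed

lemma covering_values_step:
  "covering_values n i (m + 1) - covering_values n i m =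
    2 / 2 ^ n + max 0 (1 - 4 / 2 ^ i) * of_bool (2 ^ (n + 1 - i) dvd m)"
proof -
  have "covering_values n i (m + 1) - covering_values n i m = 2 / 2 ^ n + max 0 (1 - 4 / 2 ^ i) *
      of_int (m div 2 ^ (n + 1 - i) - (m - 1) div 2 ^ (n + 1 - i))"
    by (simp add: covering_values_def field_simps)
  then show ?thesis by (simp add: div_diff_pred_div)
qed

lemma ordered_slopes_covering:
  assumes "n \<ge> 1"
  shows "ordered_slopes n (\<lambda>i. interpolate (covering_values n i))"
proof (rule ordered_slopes_interpolate[where c = "2 / 2 ^ n" and C = "2 / 2 ^ n + 1", OF assms])
  fix i :: nat and m :: int assume i: "i \<in> {1..<n}"
  have "4 / 2 ^ (i + 1) \<le> (4 / 2 ^ i :: real)" by (simp add: field_simps)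
  moreover have "(2 ^ (n + 1 - (i + 1)) :: int) dvd 2 ^ (n + 1 - i)"
    by (intro le_imp_power_dvd) simp
  then have "of_bool (2 ^ (n + 1 - i) dvd m) \<le> (of_bool (2 ^ (n + 1 - (i + 1)) dvd m) :: real)"
    using dvd_trans by fastforce
  ultimately show "covering_values n i (m + 1) - covering_values n i m
      \<le> covering_values n (i + 1) (m + 1) - covering_values n (i + 1) m"
    unfolding covering_values_step by (intro add_left_mono mult_mono) auto
qed (auto simp: covering_values_step)

lemma odd_multiple_of_power_2:
  fixes m :: int
  assumes "\<not> 2 ^ N dvd m"
  obtains v q where "v < N" "m = 2 ^ v * (2 * q + 1)"
  using assms
proof (induction N arbitrary: thesis)
  case (Suc N)
  show ?case
  proof (cases "2 ^ N dvd m")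
    case True
    then obtain k where k: "m = 2 ^ N * k" ..
    with Suc.prems(2) have "odd k" by auto
    then obtain q where "k = 2 * q + 1" by (elim oddE)
    with k show ?thesis using Suc.prems(1)[of N q] by simp
  next
    case False
    then show ?thesis using Suc.IH Suc.prems(1) by (metis less_Suc_eq)
  qed
qed simp

lemma interpolate_near_int:
  assumes "a \<lfloor>x\<rfloor> = of_int k - e" "a (\<lfloor>x\<rfloor> + 1) = of_int k + e"
  shows "\<parallel>interpolate a x\<parallel>\<^sub>\<int> \<le> \<bar>e\<bar>"
proof -
  have "interpolate a x - of_int k = e * (2 * frac x - 1)"
    unfolding interpolate_def assms by (simp add: algebra_simps)
  then have "dist (interpolate a x) (of_int k) = \<bar>e\<bar> * \<bar>2 * frac x - 1\<bar>"
    by (simp add: dist_real_def abs_mult)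
  also have "\<dots> \<le> \<bar>e\<bar>"
    using frac_lt_1[of x] frac_ge_0[of x] by (intro mult_left_le) (auto simp: abs_le_iff)
  finally show ?thesis unfolding dist_int_def by (intro infdist_le2[of "of_int k"]) auto
qed

text \<open>The function is found from the power of 2 in \<open>\<lfloor>x\<rfloor>\<close>: on the cell of \<open>x\<close>, the function to
  which this cell is assigned moves from \<open>1 / 2 ^ n\<close> below an integer to \<open>1 / 2 ^ n\<close> above it.\<close>

lemma covering_near_int:
  assumes "n \<ge> 1"
  obtains i where "i \<in> {1..n}" "\<parallel>interpolate (covering_values n i) x\<parallel>\<^sub>\<int> \<le> 1 / 2 ^ n"
proof -
  define m where "m = \<lfloor>x\<rfloor>"
  have "\<exists>i\<in>{1..n}. \<exists>k. covering_values n i m = of_int k - 1 / 2 ^ n \<and>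
      covering_values n i (m + 1) = of_int k + 1 / 2 ^ n"
  proof (cases "2 ^ (n - 1) dvd m")
    case True
    then obtain q where q: "m = 2 ^ (n - 1) * q" ..
    have "(2::real) ^ n = 2 * 2 ^ (n - 1)" using assms by (cases n) auto
    then have "2 * real_of_int m / 2 ^ n = of_int q" by (simp add: q)
    then have "covering_values n 1 m = of_int (q - 1) - 1 / 2 ^ n"
      by (simp add: covering_values_def diff_divide_distrib)
    moreover from this have "covering_values n 1 (m + 1) = of_int (q - 1) + 1 / 2 ^ n"
      using covering_values_step[of n 1 m] by simp
    ultimately show ?thesis using assms by (intro bexI[of _ 1] exI[of _ "q - 1"] conjI) auto
  next
    case False
    then obtain v q where v: "v < n - 1" and m: "m = 2 ^ v * (2 * q + 1)"
      by (rule odd_multiple_of_power_2)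
    define i where "i = n - v"
    have i: "i \<in> {1..n}" "2 \<le> i" "n + 1 - i = v + 1" using v by (auto simp: i_def)
    have "n = i + v" using v by (auto simp: i_def)
    then have scale: "(2::real) ^ n = 2 ^ i * 2 ^ v" by (simp add: power_add)
    have "(2::real) ^ 2 \<le> 2 ^ i" using i(2) by (intro power_increasing) auto
    then have speed: "max 0 (1 - 4 / 2 ^ i) = (1 - 4 / 2 ^ i :: real)" by simp
    have "(m - 1) div 2 ^ (v + 1) = q"
      by (rule int_div_pos_eq[where r = "2 ^ v - 1"]) (auto simp: m algebra_simps intro: add_pos_pos)
    then have "covering_values n i m = (2 * of_int m - 1) / 2 ^ n + (1 - 4 / 2 ^ i) * q - 2 / 2 ^ i"
      unfolding covering_values_def i(3) speed by simp
    also have "\<dots> = of_int q - 1 / 2 ^ n"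
      by (simp add: m scale field_simps)
    finally have low: "covering_values n i m = of_int q - 1 / 2 ^ n" .
    have "\<not> 2 ^ (v + 1) dvd m" by (simp add: m)
    then have "covering_values n i (m + 1) = of_int q + 1 / 2 ^ n"
      using covering_values_step[of n i m] low i(3) by simp
    with low i(1) show ?thesis by blast
  qed
  then show ?thesis using that interpolate_near_int[of _ x _ "1 / 2 ^ n"] by (auto simp: m_def)
qed

section \<open>The optimal distance\<close>

theorem corollary4p2:
  fixes n :: nat
  assumes "n \<ge> 1"
  shows "(\<forall>f. ordered_slopes n f \<longrightarrow> (\<exists>t>0. Min ((\<lambda>i. \<parallel>f i t\<parallel>\<^sub>\<int>) ` {1..n}) \<ge> 1 / 2 ^ n)) \<and>
    (\<forall>c>1 / 2 ^ n. \<not> (\<forall>f. ordered_slopes n f \<longrightarrow>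
      (\<exists>t>0. Min ((\<lambda>i. \<parallel>f i t\<parallel>\<^sub>\<int>) ` {1..n}) \<ge> c)))"
proof (intro conjI allI impI notI)
  fix f assume "ordered_slopes n f"
  from nested_intervals_far_from_int[OF this assms order_refl]
  obtain a b where "0 < a" "a \<le> b" "\<forall>i\<in>{1..n}. \<forall>t\<in>{a..b}. 1 / 2 ^ n \<le> \<parallel>f i t\<parallel>\<^sub>\<int>"
    by blast
  then show "\<exists>t>0. Min ((\<lambda>i. \<parallel>f i t\<parallel>\<^sub>\<int>) ` {1..n}) \<ge> 1 / 2 ^ n"
    using assms by (intro exI[of _ a]) auto
next
  fix c :: real
  assume c: "1 / 2 ^ n < c"
    and "\<forall>f. ordered_slopes n f \<longrightarrow> (\<exists>t>0. Min ((\<lambda>i. \<parallel>f i t\<parallel>\<^sub>\<int>) ` {1..n}) \<ge> c)"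
  then obtain t where t: "c \<le> Min ((\<lambda>i. \<parallel>interpolate (covering_values n i) t\<parallel>\<^sub>\<int>) ` {1..n})"
    using ordered_slopes_covering[OF assms] by blast
  obtain i where i: "i \<in> {1..n}" "\<parallel>interpolate (covering_values n i) t\<parallel>\<^sub>\<int> \<le> 1 / 2 ^ n"
    using covering_near_int[OF assms] .
  have "c \<le> \<parallel>interpolate (covering_values n i) t\<parallel>\<^sub>\<int>"
    using t i(1) by (auto intro: order_trans[OF _ Min_le])
  with i(2) c show False by linarith
qed

end
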